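(* Let $E$ be an effect algebra containing an atom $p$ with $2\le\operatorname{ord}(p)<\infty$. Then $E$ admits no total binary operation satisfying (S1)–(S4).
   Context: An effect algebra is $(E,0,1,\oplus)$ with $\oplus$ a partial binary operation that is commutative, associative (in the partial sense), has for each $a$ a unique orthosupplement $a'$ with $a\oplus a'=1$, and satisfies: $a\oplus 1$ defined implies $a=0$. Write $a\perp b$ when $a\oplus b$ is defined; $a\le b$ iff $b=a\oplus c$ for some $c$. An atom is a minimal nonzero element. For $n\in\mathbb{N}$, $na=a\oplus\cdots\oplus a$ ($n$ times) when defined, and $\operatorname{ord}(a)=\sup\{n: na \text{ exists}\}\in\mathbb{N}\cup\{\infty\}$ is the isotropic index. For a total binary operation $\circ$ on $E$, write $a\mid b$ for $a\circ b=b\circ a$. Axioms: (S1) $b\perp c\Rightarrow a\circ(b\oplus c)=(a\circ b)\oplus(a\circ c)$; (S2) $1\circ a=a$; (S3) $a\circ b=0\Rightarrow a\circ b=b\circ a$; (S4) if $a\mid b$ then $a\mid b'$ and $a\circ(b\circ c)=(a\circ b)\circ c$ for all $c$. *)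

theory Defs
  imports "HOL-Library.Extended_Nat"
begin

(* The partial operation is option-valued: a \<oplus> b = None means that the sum is undefined.
   Its values on arguments outside the carrier are irrelevant. *)
record 'a effect_algebra =
  carrier :: "'a set"
  ezero :: 'a ("\<zero>\<index>")
  eone :: 'a ("\<one>\<index>")
  eplus :: "'a \<Rightarrow> 'a \<Rightarrow> 'a option" (infixl "\<oplus>\<index>" 65)

locale effect_algebra =
  fixes E :: "('a, 'm) effect_algebra_scheme" (structure)
  assumes zero_closed: "\<zero> \<in> carrier E"
    and one_closed: "\<one> \<in> carrier E"
    and plus_closed:
      "\<lbrakk>a \<in> carrier E; b \<in> carrier E; a \<oplus> b = Some c\<rbrakk> \<Longrightarrow> c \<in> carrier E"
    and plus_commute:
      "\<lbrakk>a \<in> carrier E; b \<in> carrier E; a \<oplus> b = Some c\<rbrakk> \<Longrightarrow> b \<oplus> a = Some c"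
    and plus_assoc:
      "\<lbrakk>a \<in> carrier E; b \<in> carrier E; c \<in> carrier E; a \<oplus> b = Some d; d \<oplus> c = Some e\<rbrakk>
        \<Longrightarrow> \<exists>f. b \<oplus> c = Some f \<and> a \<oplus> f = Some e"
    and orthosupplement_unique:
      "a \<in> carrier E \<Longrightarrow> \<exists>!b. b \<in> carrier E \<and> a \<oplus> b = Some \<one>"
    and plus_one_defined:
      "\<lbrakk>a \<in> carrier E; a \<oplus> \<one> \<noteq> None\<rbrakk> \<Longrightarrow> a = \<zero>"

definition orthosupplement :: "('a, 'm) effect_algebra_scheme \<Rightarrow> 'a \<Rightarrow> 'a" where
  "orthosupplement E a = (THE b. b \<in> carrier E \<and> a \<oplus>\<^bsub>E\<^esub> b = Some \<one>\<^bsub>E\<^esub>)"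

definition ea_le :: "('a, 'm) effect_algebra_scheme \<Rightarrow> 'a \<Rightarrow> 'a \<Rightarrow> bool" where
  "ea_le E a b \<longleftrightarrow> (\<exists>c \<in> carrier E. a \<oplus>\<^bsub>E\<^esub> c = Some b)"

definition ea_atom :: "('a, 'm) effect_algebra_scheme \<Rightarrow> 'a \<Rightarrow> bool" where
  "ea_atom E p \<longleftrightarrow> p \<in> carrier E \<and> p \<noteq> \<zero>\<^bsub>E\<^esub> \<and>
     (\<forall>b \<in> carrier E. b \<noteq> \<zero>\<^bsub>E\<^esub> \<and> ea_le E b p \<longrightarrow> b = p)"

fun ea_multiple :: "('a, 'm) effect_algebra_scheme \<Rightarrow> nat \<Rightarrow> 'a \<Rightarrow> 'a option" where
  "ea_multiple E 0 a = Some \<zero>\<^bsub>E\<^esub>"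
| "ea_multiple E (Suc 0) a = Some a"
| "ea_multiple E (Suc (Suc n)) a = Option.bind (ea_multiple E (Suc n) a) (\<lambda>x. x \<oplus>\<^bsub>E\<^esub> a)"

definition isotropic_index :: "('a, 'm) effect_algebra_scheme \<Rightarrow> 'a \<Rightarrow> enat" where
  "isotropic_index E a = Sup {enat n | n. ea_multiple E n a \<noteq> None}"

definition commuting :: "('a \<Rightarrow> 'a \<Rightarrow> 'a) \<Rightarrow> 'a \<Rightarrow> 'a \<Rightarrow> bool" where
  "commuting f a b \<longleftrightarrow> f a b = f b a"

locale sequential_operation = effect_algebra E
  for E :: "('a, 'm) effect_algebra_scheme" (structure) +
  fixes f :: "'a \<Rightarrow> 'a \<Rightarrow> 'a" (infixl "\<odot>" 70)
  assumes closed: "\<lbrakk>a \<in> carrier E; b \<in> carrier E\<rbrakk> \<Longrightarrow> a \<odot> b \<in> carrier E"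
    and S1: "\<lbrakk>a \<in> carrier E; b \<in> carrier E; c \<in> carrier E; b \<oplus> c = Some d\<rbrakk>
        \<Longrightarrow> (a \<odot> b) \<oplus> (a \<odot> c) = Some (a \<odot> d)"
    and S2: "a \<in> carrier E \<Longrightarrow> \<one> \<odot> a = a"
    and S3: "\<lbrakk>a \<in> carrier E; b \<in> carrier E; a \<odot> b = \<zero>\<rbrakk> \<Longrightarrow> a \<odot> b = b \<odot> a"
    and S4_orthosupplement:
      "\<lbrakk>a \<in> carrier E; b \<in> carrier E; commuting (\<odot>) a b\<rbrakk>
        \<Longrightarrow> commuting (\<odot>) a (orthosupplement E b)"
    and S4_assoc:
      "\<lbrakk>a \<in> carrier E; b \<in> carrier E; c \<in> carrier E; commuting (\<odot>) a b\<rbrakk>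
        \<Longrightarrow> a \<odot> (b \<odot> c) = (a \<odot> b) \<odot> c"

end

(* Since p is an atom and p \<odot> b \<le> p, always p \<odot> b is \<zero> or p. From p \<le> p' one gets p \<odot> p = \<zero>, hence
   p \<odot> (np) = \<zero> for n = ord p. So p commutes with np by (S3) and with c = (np)' by (S4), and
   c \<odot> p = p \<odot> c = p. Thus p = c \<odot> p \<le> c = (np)', so (n+1)p exists: a contradiction. *)
theory Submission
  imports Defs
begin

context effect_algebra
begin

lemma
  assumes "a \<in> carrier E"
  shows orthosupplement_closed: "orthosupplement E a \<in> carrier E"
    and plus_orthosupplement: "a \<oplus> orthosupplement E a = Some \<one>"
  using theI'[OF orthosupplement_unique[OF assms]] unfolding orthosupplement_def by simp_all

lemma orthosupplement_eqI:
  "\<lbrakk>a \<in> carrier E; b \<in> carrier E; a \<oplus> b = Some \<one>\<rbrakk> \<Longrightarrow> orthosupplement E a = b"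
  using orthosupplement_unique orthosupplement_closed plus_orthosupplement by blast

text \<open>Regrouping (x + a) + a' = 1 as x + (a + a') = x + 1 makes x + 1 defined, which forces x
  = 0. This is the one form of cancellation used below.\<close>

lemma plus_eq_self:
  assumes "a \<in> carrier E" "x \<in> carrier E" "a \<oplus> x = Some a"
  shows "x = \<zero>"
proof -
  have "x \<oplus> a = Some a"
    using assms plus_commute by blast
  then obtain g where "a \<oplus> orthosupplement E a = Some g" "x \<oplus> g = Some \<one>"
    using plus_assoc assms orthosupplement_closed plus_orthosupplement by meson
  then show ?thesis
    using assms plus_orthosupplement plus_one_defined by auto
qed

lemma one_plus_zero: "\<one> \<oplus> \<zero> = Some \<one>"
proof -
  let ?b = "orthosupplement E \<one>"
  have b: "?b \<in> carrier E" "\<one> \<oplus> ?b = Some \<one>"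
    using one_closed orthosupplement_closed plus_orthosupplement by auto
  \<comment> \<open>The orthosupplement of 1 is absorbed by 1, so cancellation applies to
    it.\<close>
  then have "?b = \<zero>"
    using plus_eq_self one_closed by blast
  with b show ?thesis by simp
qed

lemma zero_plus_one: "\<zero> \<oplus> \<one> = Some \<one>"
  using one_plus_zero plus_commute one_closed zero_closed by blast

lemma orthosupplement_zero: "orthosupplement E \<zero> = \<one>"
  by (simp add: orthosupplement_eqI one_closed zero_closed zero_plus_one)

text \<open>Regroup (1 + 0) + 0 = 1 as 1 + (0 + 0) = 1 and cancel.\<close>

lemma zero_plus_zero: "\<zero> \<oplus> \<zero> = Some \<zero>"
proof -
  obtain g where g: "\<zero> \<oplus> \<zero> = Some g" "\<one> \<oplus> g = Some \<one>"
    using plus_assoc one_closed zero_closed one_plus_zero by meson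
  then show ?thesis
    using plus_eq_self plus_closed one_closed zero_closed by metis
qed

text \<open>Since (b + a) + 1 = 0 + 1 is defined, so is a + 1.\<close>

lemma plus_eq_zero:
  assumes "a \<in> carrier E" "b \<in> carrier E" "a \<oplus> b = Some \<zero>"
  shows "a = \<zero>"
proof -
  have "b \<oplus> a = Some \<zero>"
    using assms plus_commute by blast
  then have "a \<oplus> \<one> \<noteq> None"
    using plus_assoc[of b a \<one>] assms one_closed zero_plus_one by fastforce
  then show ?thesis
    using assms plus_one_defined by blast
qed

text \<open>If b' = r + a, then (r + a) + b = 1 regroups as r + (a + b), so a + b exists.\<close>

lemma plus_defined_if_le_orthosupplement:
  assumes "a \<in> carrier E" "b \<in> carrier E" "ea_le E a (orthosupplement E b)"
  shows "b \<oplus> a \<noteq> None"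
proof -
  obtain r where r: "r \<in> carrier E" "a \<oplus> r = Some (orthosupplement E b)"
    using assms unfolding ea_le_def by blast
  have "r \<oplus> a = Some (orthosupplement E b)" "orthosupplement E b \<oplus> b = Some \<one>"
    using r assms plus_commute orthosupplement_closed plus_orthosupplement by blast+
  then obtain g where "a \<oplus> b = Some g"
    using plus_assoc r assms by meson
  then have "b \<oplus> a = Some g"
    using plus_commute assms by blast
  then show ?thesis by simp
qed

lemma le_orthosupplement_if_plus_defined:
  assumes "a \<in> carrier E" "b \<in> carrier E" "b \<oplus> a \<noteq> None"
  shows "ea_le E a (orthosupplement E b)"
proof -
  obtain d where d: "b \<oplus> a = Some d" "d \<in> carrier E"
    using assms plus_closed by blast
  \<comment> \<open>From (b + a) + d' = 1 one gets b + (a + d') = 1; uniqueness then gives b' = a +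
    d', so d' witnesses a \<le> b'.\<close>
  let ?r = "orthosupplement E d"
  have r: "?r \<in> carrier E" "d \<oplus> ?r = Some \<one>"
    using d orthosupplement_closed plus_orthosupplement by auto
  obtain g where g: "a \<oplus> ?r = Some g" "b \<oplus> g = Some \<one>"
    using plus_assoc d r assms by meson
  then have "orthosupplement E b = g"
    using orthosupplement_eqI plus_closed assms r by blast
  then show ?thesis
    using g r unfolding ea_le_def by blast
qed

lemma multiple_closed:
  assumes "a \<in> carrier E"
  shows "ea_multiple E n a = Some x \<Longrightarrow> x \<in> carrier E"
proof (induction n arbitrary: x)
  case (Suc n)
  show ?case
  proof (cases n)
    case 0
    with Suc.prems assms show ?thesis by simp
  next
    case (Suc m)
    then obtain y where "ea_multiple E n a = Some y" "y \<oplus> a = Some x"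
      using Suc.prems by (auto simp: bind_eq_Some_conv)
    then show ?thesis
      using Suc.IH assms plus_closed by blast
  qed
qed (use zero_closed in simp)

end

text \<open>\<open>Option.bind\<close> propagates failure: if 2p is undefined, so are all later
  multiples, and the supremum is at most 1.\<close>

lemma isotropic_index_ge_2D:
  assumes "2 \<le> isotropic_index E p"
  shows "p \<oplus>\<^bsub>E\<^esub> p \<noteq> None"
proof
  assume none: "p \<oplus>\<^bsub>E\<^esub> p = None"
  have "ea_multiple E (Suc (Suc n)) p = None" for n
    using none by (induction n) auto
  then have "n \<le> 1" if "ea_multiple E n p \<noteq> None" for n
    using that by (cases n; cases "n - 1") auto
  then have "isotropic_index E p \<le> 1"
    unfolding isotropic_index_def by (auto intro!: Sup_least simp: one_enat_def)
  with assms have "(2::enat) \<le> 1"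
    by (rule order_trans)
  then show False
    by (simp add: one_enat_def numeral_eq_enat)
qed

lemma isotropic_index_finite_maximal_multiple:
  assumes "isotropic_index E p < \<infinity>"
  obtains n q where "ea_multiple E n p = Some q" "q \<oplus>\<^bsub>E\<^esub> p = None"
proof -
  obtain k where k: "isotropic_index E p = enat k"
    using assms by (cases "isotropic_index E p") auto
  have "ea_multiple E (Suc k) p = None"
  proof (rule ccontr)
    assume "ea_multiple E (Suc k) p \<noteq> None"
    then have "enat (Suc k) \<le> isotropic_index E p"
      unfolding isotropic_index_def by (intro Sup_upper) blast
    then show False
      using k by simp
  qed
  then obtain m where "ea_multiple E (Suc m) p = None" "\<forall>i\<le>m. ea_multiple E i p \<noteq> None"
    using ex_least_nat_less[of "\<lambda>i. ea_multiple E i p = None"]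
    by (metis ea_multiple.simps(1) option.distinct(1) zero_less_Suc)
  \<comment> \<open>The first undefined multiple is not 1p, which is p by definition. Hence it
    unfolds by the last equation of \<open>ea_multiple\<close>, and the failing sum is mp +
    p.\<close>
  moreover from this obtain l where "m = Suc l"
    by (cases m) auto
  ultimately show ?thesis
    using that by force
qed

context sequential_operation
begin

text \<open>Apply (S1) to 0 + 0 = 0 and cancel.\<close>

lemma mult_zero:
  assumes "a \<in> carrier E"
  shows "a \<odot> \<zero> = \<zero>"
  using S1[OF assms zero_closed zero_closed zero_plus_zero] plus_eq_self closed assms zero_closed
  by blast

text \<open>(S2) has 1 on the left only; a commutes with 0 by (S3), hence with 0' = 1 by
  (S4).\<close>

lemma mult_one:
  assumes "a \<in> carrier E"
  shows "a \<odot> \<one> = a"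
proof -
  have "commuting (\<odot>) a \<zero>"
    using S3 mult_zero assms zero_closed unfolding commuting_def by blast
  then have "commuting (\<odot>) a \<one>"
    using S4_orthosupplement assms zero_closed orthosupplement_zero by fastforce
  then show ?thesis
    using S2 assms unfolding commuting_def by simp
qed

lemma mult_plus_mult_orthosupplement:
  assumes "a \<in> carrier E" "b \<in> carrier E"
  shows "(a \<odot> b) \<oplus> (a \<odot> orthosupplement E b) = Some a"
  using S1[OF assms orthosupplement_closed plus_orthosupplement] assms mult_one by simp

lemma mult_le: "\<lbrakk>a \<in> carrier E; b \<in> carrier E\<rbrakk> \<Longrightarrow> ea_le E (a \<odot> b) a"
  unfolding ea_le_def using mult_plus_mult_orthosupplement closed orthosupplement_closed by blast

lemma atom_mult:
  "\<lbrakk>ea_atom E p; b \<in> carrier E\<rbrakk> \<Longrightarrow> p \<odot> b = \<zero> \<or> p \<odot> b = p"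
  using mult_le closed unfolding ea_atom_def by blast

lemma atom_mult_self:
  assumes p: "ea_atom E p" and defined: "p \<oplus> p \<noteq> None"
  shows "p \<odot> p = \<zero>"
proof (rule ccontr)
  assume "p \<odot> p \<noteq> \<zero>"
  have pc: "p \<in> carrier E" and p0: "p \<noteq> \<zero>"
    using p unfolding ea_atom_def by auto
  with \<open>p \<odot> p \<noteq> \<zero>\<close> have pp: "p \<odot> p = p"
    using atom_mult p by blast
  \<comment> \<open>The splitting of p along p and p' has first summand p, so the second cancels to
    0.\<close>
  have "p \<odot> orthosupplement E p = \<zero>"
    using mult_plus_mult_orthosupplement[OF pc pc] pp plus_eq_self pc closed orthosupplement_closed
    by metis
  moreover obtain r where r: "r \<in> carrier E" "p \<oplus> r = Some (orthosupplement E p)"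
    using le_orthosupplement_if_plus_defined[OF pc pc defined] unfolding ea_le_def by blast
  \<comment> \<open>(S1) along p' = p + r: the product of p with p' is 0, yet it has p as a
    summand.\<close>
  ultimately have "p \<oplus> (p \<odot> r) = Some \<zero>"
    using S1[OF pc pc r] pp by simp
  then show False
    using plus_eq_zero closed pc r p0 by blast
qed

lemma mult_multiple_eq_zero:
  assumes "a \<in> carrier E" "a \<odot> a = \<zero>"
  shows "ea_multiple E n a = Some x \<Longrightarrow> a \<odot> x = \<zero>"
proof (induction n arbitrary: x)
  case 0
  then show ?case
    using mult_zero assms by simp
next
  case (Suc n)
  show ?case
  proof (cases n)
    case 0
    with Suc.prems assms show ?thesis by simp
  next
    case (Suc m)
    then obtain y where y: "ea_multiple E n a = Some y" "y \<oplus> a = Some x"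
      using Suc.prems by (auto simp: bind_eq_Some_conv)
    have "(a \<odot> y) \<oplus> (a \<odot> a) = Some (a \<odot> x)"
      using S1 y multiple_closed assms by blast
    then show ?thesis
      using Suc.IH y assms zero_plus_zero by simp
  qed
qed

text \<open>The bound \<open>mult_le\<close> concerns the left factor. Commutation of p with q' puts
  q' on the left, turning p = p \<odot> q' into p \<le> q'.\<close>

lemma atom_plus_defined_if_mult_eq_zero:
  assumes p: "ea_atom E p" and q: "q \<in> carrier E" and pq: "p \<odot> q = \<zero>"
  shows "q \<oplus> p \<noteq> None"
proof -
  let ?c = "orthosupplement E q"
  have pc: "p \<in> carrier E" and p0: "p \<noteq> \<zero>"
    using p unfolding ea_atom_def by auto
  have c: "?c \<in> carrier E"
    using q orthosupplement_closed by blast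
  \<comment> \<open>Otherwise both summands in the splitting of p along q and q' would be 0, giving
    p = 0.\<close>
  have "p \<odot> ?c \<noteq> \<zero>"
    using mult_plus_mult_orthosupplement[OF pc q] pq zero_plus_zero p0 by auto
  then have "p \<odot> ?c = p"
    using atom_mult p c by blast
  moreover have "commuting (\<odot>) p ?c"
    using S4_orthosupplement S3 pc q pq unfolding commuting_def by blast
  ultimately have "?c \<odot> p = p"
    unfolding commuting_def by simp
  then have "ea_le E p ?c"
    using mult_le[OF c pc] by simp
  then show ?thesis
    using plus_defined_if_le_orthosupplement pc q by blast
qed

end

theorem theorem4p1:
  fixes E :: "('a, 'm) effect_algebra_scheme" and p :: 'a
  assumes "effect_algebra E"
    and "ea_atom E p"
    and "2 \<le> isotropic_index E p"
    and "isotropic_index E p < \<infinity>"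
  shows "\<not> (\<exists>f. sequential_operation E f)"
proof
  assume "\<exists>f. sequential_operation E f"
  then obtain f where "sequential_operation E f" ..
  then interpret sequential_operation E f .
  obtain n q where q: "ea_multiple E n p = Some q" "q \<oplus>\<^bsub>E\<^esub> p = None"
    using isotropic_index_finite_maximal_multiple assms(4) by metis
  have p: "p \<in> carrier E"
    using assms(2) unfolding ea_atom_def by blast
  have "f p p = \<zero>\<^bsub>E\<^esub>"
    using atom_mult_self assms(2) isotropic_index_ge_2D[OF assms(3)] by blast
  then have "f p q = \<zero>\<^bsub>E\<^esub>"
    using mult_multiple_eq_zero p q(1) by blast
  \<comment> \<open>q is the last defined multiple of p, yet p annihilates it, so q + p would
    exist.\<close>
  then show False
    using atom_plus_defined_if_mult_eq_zero assms(2) multiple_closed p q by blast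
qed

end
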